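(* Let $\vartheta$ be a primitive compatible random substitution such that $X_\vartheta$ is $C$-balanced (for some constant $C$). There exists a constant $N$ such that if $\vartheta$ admits a level-$n$ recognisable word for some $n\ge N$, then the RS-subshift $X_\vartheta$ is not topologically mixing.
   Context: Words and random substitutions. $\mathcal{A}=\{a_1,\dots,a_d\}$ is a finite alphabet, $\mathcal{A}^+$ the set of non-empty finite words over $\mathcal{A}$, $|w|$ the length of $w$, $|w|_a$ the number of occurrences of the letter $a$ in $w$; a subword is a contiguous factor $w_{[i,j]}=w_i\cdots w_j$. A random substitution $\vartheta$ assigns to each $a\in\mathcal{A}$ a non-empty finite set $\vartheta(a)\subset\mathcal{A}^+$. It extends to words by $\vartheta(v_1\cdots v_m)=\{w_1\cdots w_m : w_i\in\vartheta(v_i)\}$ and to sets of words by $\vartheta(B)=\bigcup_{w\in B}\vartheta(w)$, so the powers $\vartheta^k$ are defined. A word is $\vartheta$-legal if it is a subword of some element of $\vartheta^k(a)$ for some $k\ge 1$, $a\in\mathcal{A}$. $X_\vartheta\subset\mathcal{A}^{\mathbb{Z}}$ is the set of bi-infinite sequences all of whose finite subwords are $\vartheta$-legal (the RS-subshift), with the shift action $\sigma$. Subshifts are by definition non-empty, so $X_\vartheta$ is understood to be non-empty (this excludes only the degenerate one-letter case $a\mapsto\{a\}$ among primitive compatible $\vartheta$). $\vartheta$ is compatible if, for each $a\in\mathcal{A}$, all words in $\vartheta(a)$ have the same number of occurrences of each letter. Then the substitution matrix $M_\vartheta$ has $(i,j)$ entry equal to the common number of $a_i$'s in the words of $\vartheta(a_j)$.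 $\vartheta$ is primitive if some power of $M_\vartheta$ has all entries positive. A subshift $X$ with language $\mathcal{L}(X)$ (the set of finite subwords of elements of $X$) is $C$-balanced if there is a constant $C$ such that $\big||w|_a-|w'|_a\big|\le C$ for every letter $a$ and all $w,w'\in\mathcal{L}(X)$ with $|w|=|w'|$. $X$ is topologically mixing if for all $u,v\in\mathcal{L}(X)$ there is $N$ such that for every $n\ge N$ there is a word $w$ of length $n$ with $uwv\in\mathcal{L}(X)$. Recognisable words. For $n\ge1$, a level-$n$ inflation word decomposition of a legal word $u$ is a pair $([u_1,\dots,u_\ell],v)$ where $u_i\in\mathcal{A}^+$, $u_1\cdots u_\ell=u$, $v=v_1\cdots v_\ell$ is $\vartheta$-legal, $u_i\in\vartheta^n(v_i)$ for $2\le i\le \ell-1$, $u_1$ is a suffix of an element of $\vartheta^n(v_1)$ and $u_\ell$ is a prefix of an element of $\vartheta^n(v_\ell)$ (if $\ell=1$, $u_1$ is a subword of an element of $\vartheta^n(v_1)$). For $1\le i\le j\le |u|$, such a decomposition induces the decomposition $([\hat u_{k(i)},u_{k(i)+1},\dots,u_{k(j)-1},\hat u_{k(j)}],v_{[k(i),k(j)]})$ of $u_{[i,j]}$, where $k(i),k(j)$ are the indices of the pieces containing positions $i$ and $j$ of $u$ (i.e. $|u_1\cdots u_{k(i)-1}|<i\le|u_1\cdots u_{k(i)}|$ and likewise for $j$), and $\hat u_{k(i)}$, $\hat u_{k(j)}$ are the suffix of $u_{k(i)}$ and prefix of $u_{k(j)}$ for which the concatenation equals $u_{[i,j]}$ (if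 $k(i)=k(j)$, the induced decomposition is $([u_{[i,j]}],v_{k(i)})$). A legal word $u$ is level-$n$ recognisable if there is a natural number $R$ such that for each legal word $w=u^{(l)}uu^{(r)}$ with $|u^{(l)}|=|u^{(r)}|=R$, all level-$n$ inflation word decompositions of $w$ induce the same level-$n$ decomposition of this occurrence of $u$.
   Formalization: The alphabet is assumed to have at least two letters; for one letter with a mapped to {a^k}, k ≥ 2, the claim fails, since the subshift is a single fixed point, balanced and mixing, while the word a is recognisable at every level. *)

theory Defs
  imports "HOL-Analysis.Analysis" "HOL-Library.Sublist"
begin

text \<open>
  The alphabet is a type of class \<^class>\<open>finite\<close>; words are lists. The empty list is not a
  word: it is excluded from the values of a random substitution, from the legal words and from the
  language of a subshift. Positions in words are counted from 0.

  Statements about recognisable words need an alphabet with at least two letters: if the only letter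
  \<open>a\<close> is mapped to \<open>{replicate k a}\<close> with \<open>k \<ge> 2\<close>, the subshift is a single fixed point, hence mixing,
  and yet the word \<open>a\<close> is recognisable at every level, as it only has the decomposition \<open>([a], a)\<close>.
\<close>

definition random_substitution :: "('a::finite \<Rightarrow> 'a list set) \<Rightarrow> bool" where
  "random_substitution \<theta> \<longleftrightarrow> (\<forall>a. finite (\<theta> a) \<and> \<theta> a \<noteq> {} \<and> [] \<notin> \<theta> a)"

definition subst_word :: "('a \<Rightarrow> 'a list set) \<Rightarrow> 'a list \<Rightarrow> 'a list set" where
  "subst_word \<theta> v = concat ` listset (map \<theta> v)"

definition subst_words :: "('a \<Rightarrow> 'a list set) \<Rightarrow> 'a list set \<Rightarrow> 'a list set" where
  "subst_words \<theta> B = (\<Union>w\<in>B. subst_word \<theta> w)"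

definition subst_power :: "('a \<Rightarrow> 'a list set) \<Rightarrow> nat \<Rightarrow> 'a \<Rightarrow> 'a list set" where
  "subst_power \<theta> k a = (subst_words \<theta> ^^ k) {[a]}"

definition legal :: "('a \<Rightarrow> 'a list set) \<Rightarrow> 'a list \<Rightarrow> bool" where
  "legal \<theta> u \<longleftrightarrow> u \<noteq> [] \<and> (\<exists>k\<ge>1. \<exists>a. \<exists>w \<in> subst_power \<theta> k a. sublist u w)"

definition compatible :: "('a \<Rightarrow> 'a list set) \<Rightarrow> bool" where
  "compatible \<theta> \<longleftrightarrow>
    (\<forall>a. \<forall>u \<in> \<theta> a. \<forall>w \<in> \<theta> a. \<forall>b. count_list u b = count_list w b)"

text \<open>Row \<open>i\<close>, column \<open>j\<close>; the description is proper when \<open>\<theta>\<close> is a compatible random substitution.\<close>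

definition subst_matrix :: "('a::finite \<Rightarrow> 'a list set) \<Rightarrow> real ^ 'a ^ 'a" where
  "subst_matrix \<theta> = (\<chi> i j. real (THE c. \<forall>w \<in> \<theta> j. count_list w i = c))"

text \<open>The power is iterated \<open>**\<close>, since \<open>^\<close> on vectors would be taken componentwise.\<close>

definition primitive :: "('a::finite \<Rightarrow> 'a list set) \<Rightarrow> bool" where
  "primitive \<theta> \<longleftrightarrow> (\<exists>k\<ge>1. \<forall>i j. (((**) (subst_matrix \<theta>) ^^ k) (mat 1)) $ i $ j > 0)"

definition rs_subshift :: "('a \<Rightarrow> 'a list set) \<Rightarrow> (int \<Rightarrow> 'a) set" where
  "rs_subshift \<theta> = {x. \<forall>i j. i \<le> j \<longrightarrow> legal \<theta> (map x [i..j])}"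

definition language :: "(int \<Rightarrow> 'a) set \<Rightarrow> 'a list set" where
  "language X = {map x [i..j] | x i j. x \<in> X \<and> i \<le> j}"

definition balanced :: "real \<Rightarrow> (int \<Rightarrow> 'a) set \<Rightarrow> bool" where
  "balanced C X \<longleftrightarrow>
    (\<forall>w \<in> language X. \<forall>w' \<in> language X. length w = length w' \<longrightarrow>
      (\<forall>a. \<bar>real (count_list w a) - real (count_list w' a)\<bar> \<le> C))"

definition topologically_mixing :: "(int \<Rightarrow> 'a) set \<Rightarrow> bool" where
  "topologically_mixing X \<longleftrightarrow>
    (\<forall>u \<in> language X. \<forall>v \<in> language X. \<exists>N. \<forall>n\<ge>N. \<exists>w. length w = n \<and> u @ w @ v \<in> language X)"

type_synonym 'a decomposition = "'a list list \<times> 'a list"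

definition inflation_decomposition ::
    "('a \<Rightarrow> 'a list set) \<Rightarrow> nat \<Rightarrow> 'a list \<Rightarrow> 'a decomposition \<Rightarrow> bool" where
  "inflation_decomposition \<theta> n u D \<longleftrightarrow> (case D of (us, v) \<Rightarrow>
     legal \<theta> u \<and> us \<noteq> [] \<and> [] \<notin> set us \<and> concat us = u \<and>
     length v = length us \<and> legal \<theta> v \<and>
     (if length us = 1
      then \<exists>y \<in> subst_power \<theta> n (hd v). sublist (hd us) y
      else (\<exists>y \<in> subst_power \<theta> n (hd v). suffix (hd us) y) \<and>
           (\<exists>y \<in> subst_power \<theta> n (last v). prefix (last us) y) \<and>
           (\<forall>i. 0 < i \<and> i < length us - 1 \<longrightarrow> us ! i \<in> subst_power \<theta> n (v ! i))))"

text \<open>\<open>segment xs i j\<close> consists of the entries of \<open>xs\<close> at the positions \<open>i, \<dots>, j\<close>, both included.\<close>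

definition segment :: "'b list \<Rightarrow> nat \<Rightarrow> nat \<Rightarrow> 'b list" where
  "segment xs i j = take (Suc j - i) (drop i xs)"

definition piece_start :: "'a list list \<Rightarrow> nat \<Rightarrow> nat" where
  "piece_start us k = length (concat (take k us))"

definition piece_index :: "'a list list \<Rightarrow> nat \<Rightarrow> nat" where
  "piece_index us i = (THE k. k < length us \<and> piece_start us k \<le> i \<and> i < piece_start us (Suc k))"

definition induced_decomposition :: "'a decomposition \<Rightarrow> nat \<Rightarrow> nat \<Rightarrow> 'a decomposition" where
  "induced_decomposition D i j = (case D of (us, v) \<Rightarrow>
     let k = piece_index us i; l = piece_index us j in
     (if k = l then [segment (concat us) i j]
      else drop (i - piece_start us k) (us ! k) #
           segment us (Suc k) (l - 1) @
           [take (Suc j - piece_start us l) (us ! l)],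
      segment v k l))"

definition recognisable :: "('a \<Rightarrow> 'a list set) \<Rightarrow> nat \<Rightarrow> 'a list \<Rightarrow> bool" where
  "recognisable \<theta> n u \<longleftrightarrow> legal \<theta> u \<and>
    (\<exists>R. \<forall>l r. length l = R \<and> length r = R \<and> legal \<theta> (l @ u @ r) \<longrightarrow>
      (\<forall>D D'. inflation_decomposition \<theta> n (l @ u @ r) D \<and>
              inflation_decomposition \<theta> n (l @ u @ r) D' \<longrightarrow>
         induced_decomposition D R (R + length u - 1) =
         induced_decomposition D' R (R + length u - 1)))"

end

theory Submission
  imports Defs
begin

text \<open>Balance forces every letter \<open>a\<close> to have a frequency \<open>\<mu>\<close>, with bounded discrepancy: the numbers
  \<open>D w = |w|\<^sub>a - \<mu> |w|\<close>, for \<open>w\<close> in the language, are bounded (\<open>balanced_frequency\<close>). Bounded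
  discrepancy is incompatible with mixing as soon as \<open>\<mu>\<close> is not an integer
  (\<open>bounded_discrepancy_imp_not_mixing\<close>): let \<open>u\<close> be a word for which \<open>|D u|\<close> is almost maximal. Then two
  separated occurrences of \<open>u\<close> in one word are only possible at distances \<open>m\<close> for which \<open>\<mu> m\<close> is close to an integer,
  since the word from the start of the first occurrence to the start of the second has discrepancy
  close to \<open>0\<close>. Mixing would allow two consecutive values of \<open>m\<close>, so that \<open>\<mu>\<close> itself would be close to
  an integer. This is the combinatorial form of the fact that bounded discrepancy makes
  \<open>exp (2 \<pi> \<i> \<mu>)\<close> a measurable eigenvalue of the shift for every invariant probability measure.

  For a primitive compatible random substitution the frequency of a letter is not an integer: every
  long legal word contains all letters (\<open>legal_words_avoiding_letter_bounded\<close>), so all letters have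
  positive frequency, and there are at least two of them.\<close>

section \<open>Languages of sets of bi-infinite sequences\<close>

lemma language_sublist:
  assumes "w \<in> language X" "sublist z w" "z \<noteq> []"
  shows "z \<in> language X"
proof -
  from assms(1) obtain x i j where x: "x \<in> X" and w: "w = map x [i..j]"
    by (auto simp: language_def)
  from assms(2) obtain p s where "w = p @ z @ s"
    by (auto simp: sublist_def)
  with w have e: "map x [i..j] = p @ z @ s"
    by simp
  define i' where "i' = i + int (length p)"
  define j' where "j' = i' + int (length z) - 1"
  have len: "nat (j - i + 1) = length p + length z + length s"
    using arg_cong[OF e, of length] by simp
  have "z = map x [i'..j']"
  proof (rule nth_equalityI)
    show "length z = length (map x [i'..j'])"
      by (simp add: j'_def)
  next
    fix m
    assume m: "m < length z"
    have "z ! m = map x [i..j] ! (length p + m)"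
      using m by (simp add: e nth_append)
    also have "\<dots> = map x [i'..j'] ! m"
      using m len by (simp add: i'_def j'_def add.assoc)
    finally show "z ! m = map x [i'..j'] ! m" .
  qed
  moreover have "i' \<le> j'"
    using assms(3) by (cases z) (simp_all add: j'_def)
  ultimately show ?thesis
    using x by (auto simp: language_def)
qed

lemma language_word_of_length:
  assumes "X \<noteq> {}" "n \<ge> 1"
  obtains w where "w \<in> language X" "length w = n"
proof -
  from assms(1) obtain x where "x \<in> X"
    by blast
  then have "map x [0..int n - 1] \<in> language X"
    using assms(2) unfolding language_def by force
  then show ?thesis
    by (rule that) simp
qed

section \<open>Letter frequencies in balanced subshifts\<close>

text \<open>For an additive \<open>f\<close>, a bound on all blocks of a fixed length is inherited, after scaling, by longer
  words. Taking \<open>f = - |\<cdot>|\<^sub>a\<close> turns it into an upper bound for \<open>|\<cdot>|\<^sub>a\<close>.\<close>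

lemma additive_lower_bound_by_blocks:
  fixes f :: "'a list \<Rightarrow> real"
  assumes "f [] = 0" and "\<And>u v. f (u @ v) = f u + f v"
    and "\<And>z. sublist z w \<Longrightarrow> length z = n \<Longrightarrow> c \<le> f z"
    and "length w = k * n"
  shows "real k * c \<le> f w"
  using assms(3,4)
proof (induction k arbitrary: w)
  case 0
  then show ?case
    by (simp add: assms(1))
next
  case (Suc k)
  have "c \<le> f (take n w)"
    using Suc.prems by (intro Suc.prems(1)) auto
  moreover have "real k * c \<le> f (drop n w)"
  proof (rule Suc.IH)
    show "length (drop n w) = k * n"
      using Suc.prems(2) by simp
    show "c \<le> f z" if "sublist z (drop n w)" "length z = n" for z
      using sublist_order.order_trans[OF that(1) sublist_drop] that(2) by (rule Suc.prems(1))
  qed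
  moreover have "f w = f (take n w) + f (drop n w)"
    by (metis append_take_drop_id assms(2))
  ultimately show ?case
    by (simp add: algebra_simps)
qed

text \<open>The bounds \<open>(|w|\<^sub>a - C) / |w|\<close> lie below all the bounds \<open>(|w'|\<^sub>a + C) / |w'|\<close>: a word of length
  \<open>|w| |w'|\<close> can be cut into blocks of length \<open>|w|\<close> as well as into blocks of length \<open>|w'|\<close>, and
  balance compares the blocks with \<open>w\<close> and with \<open>w'\<close>. The frequency is a number that
  separates the two families.\<close>

lemma balanced_frequency:
  assumes "X \<noteq> {}" "balanced C X"
  obtains \<mu> where
    "\<And>w. w \<in> language X \<Longrightarrow> \<bar>real (count_list w a) - \<mu> * real (length w)\<bar> \<le> C"
proof -
  let ?c = "\<lambda>w. real (count_list w a)"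
  let ?lo = "\<lambda>w. (?c w - C) / real (length w)"
  have bal: "\<bar>?c w - ?c w'\<bar> \<le> C"
    if "w \<in> language X" "w' \<in> language X" "length w = length w'" for w w'
    using assms(2) that by (auto simp: balanced_def)
  have pos: "length w > 0" if "w \<in> language X" for w
    using that by (auto simp: language_def)
  have cross: "?lo w \<le> (?c w' + C) / real (length w')"
    if w: "w \<in> language X" and w': "w' \<in> language X" for w w'
  proof -
    have "length w * length w' \<ge> 1"
      using pos[OF w] pos[OF w'] by (simp add: Suc_leI)
    then obtain z where z: "z \<in> language X" "length z = length w * length w'"
      using language_word_of_length[OF assms(1)] by blast
    have blocks: "\<bar>?c v - ?c y\<bar> \<le> C"
      if "v \<in> language X" "sublist y z" "length y = length v" for v y
    proof (rule bal[OF that(1)])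
      have "y \<noteq> []"
        using pos[OF that(1)] that(3) by auto
      then show "y \<in> language X"
        by (rule language_sublist[OF z(1) that(2)])
    qed (simp add: that(3))
    have "?c w - C \<le> ?c y" if "sublist y z" "length y = length w" for y
      using blocks[OF w that] by linarith
    then have "real (length w') * (?c w - C) \<le> ?c z"
      by (rule additive_lower_bound_by_blocks[where f = ?c, rotated 2])
        (simp_all only: z(2) mult.commute, simp_all)
    moreover have "- (?c w' + C) \<le> - ?c y" if "sublist y z" "length y = length w'" for y
      using blocks[OF w' that] by linarith
    then have "real (length w) * - (?c w' + C) \<le> - ?c z"
      by (rule additive_lower_bound_by_blocks[where f = "\<lambda>v. - ?c v", rotated 2])
        (simp_all only: z(2) mult.commute, simp_all)
    ultimately have "real (length w') * (?c w - C) \<le> real (length w) * (?c w' + C)"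
      by linarith
    then show ?thesis
      using pos[OF w] pos[OF w'] by (simp add: field_simps)
  qed
  obtain w0 where w0: "w0 \<in> language X"
    using language_word_of_length[OF assms(1), of 1] by auto
  define \<mu> where "\<mu> = (SUP w\<in>language X. ?lo w)"
  have bdd: "bdd_above (?lo ` language X)"
    using cross[OF _ w0] by (rule bdd_aboveI2)
  show ?thesis
  proof (rule that)
    fix w
    assume w: "w \<in> language X"
    have "?lo w \<le> \<mu>"
      unfolding \<mu>_def by (rule cSUP_upper[OF w bdd])
    moreover have "\<mu> \<le> (?c w + C) / real (length w)"
      unfolding \<mu>_def using w0 cross[OF _ w] by (intro cSUP_least) auto
    ultimately show "\<bar>?c w - \<mu> * real (length w)\<bar> \<le> C"
      using pos[OF w] by (simp add: field_simps abs_le_iff)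
  qed
qed

text \<open>Bounded gaps make the number of occurrences grow linearly, whereas frequency \<open>0\<close> would bound
  it by \<open>C\<close>.\<close>

lemma frequency_pos:
  assumes "X \<noteq> {}"
    and disc: "\<And>w. w \<in> language X \<Longrightarrow> \<bar>real (count_list w a) - \<mu> * real (length w)\<bar> \<le> C"
    and gap: "\<And>w. w \<in> language X \<Longrightarrow> a \<notin> set w \<Longrightarrow> length w \<le> G"
  shows "\<mu> > 0"
proof (rule ccontr)
  assume "\<not> \<mu> > 0"
  define k where "k = Suc (nat \<lceil>C\<rceil>)"
  have k: "real k > C"
    unfolding k_def by linarith
  obtain w where w: "w \<in> language X" "length w = k * Suc G"
    using language_word_of_length[OF assms(1), of "k * Suc G"] by (auto simp: k_def)
  have "1 \<le> real (count_list z a)" if z: "sublist z w" "length z = Suc G" for z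
  proof -
    have "z \<in> language X"
      using z by (intro language_sublist[OF w(1)]) auto
    then have "a \<in> set z"
      using gap[of z] z(2) by auto
    then have "count_list z a \<noteq> 0"
      by (simp add: count_list_0_iff)
    then show ?thesis
      by simp
  qed
  then have "real k * 1 \<le> real (count_list w a)"
    by (rule additive_lower_bound_by_blocks[where f = "\<lambda>v. real (count_list v a)", rotated 2])
      (simp_all only: w(2), simp_all)
  moreover have "\<mu> * real (length w) \<le> 0"
    using \<open>\<not> \<mu> > 0\<close> by (simp add: mult_nonpos_nonneg)
  ultimately show False
    using disc[OF w(1)] k by linarith
qed

lemma frequency_add_le_1:
  assumes "X \<noteq> {}" "a \<noteq> b"
    and a: "\<And>w. w \<in> language X \<Longrightarrow> \<bar>real (count_list w a) - \<mu> * real (length w)\<bar> \<le> C"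
    and b: "\<And>w. w \<in> language X \<Longrightarrow> \<bar>real (count_list w b) - \<nu> * real (length w)\<bar> \<le> C"
  shows "\<mu> + \<nu> \<le> 1"
proof (rule ccontr)
  assume "\<not> \<mu> + \<nu> \<le> 1"
  then have pos: "\<mu> + \<nu> - 1 > 0"
    by simp
  then obtain n where n: "2 * C < real n * (\<mu> + \<nu> - 1)"
    using reals_Archimedean3 by blast
  obtain w where w: "w \<in> language X" "length w = Suc n"
    using language_word_of_length[OF assms(1), of "Suc n"] by auto
  have "count_list w a + count_list w b \<le> length w"
    using assms(2) by (induction w) auto
  moreover have "2 * C < real (length w) * (\<mu> + \<nu> - 1)"
    using n pos by (simp add: w(2) distrib_right)
  ultimately show False
    using a[OF w(1)] b[OF w(1)] by (simp add: algebra_simps)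
qed

section \<open>Bounded discrepancy and mixing\<close>

text \<open>Let \<open>D w = |w|\<^sub>a - \<mu> |w|\<close>, let \<open>s\<close> be the supremum of \<open>|D|\<close> on the language, and choose \<open>u\<close>
  with \<open>|D u| > s - \<epsilon>\<close>. If \<open>u w u\<close> is in the language, then \<open>|D (u w)| < \<epsilon>\<close>: for \<open>D u > 0\<close> the upper
  bound comes from \<open>D (u w u) \<le> s\<close> and the lower one from \<open>D w \<ge> - s\<close>, and the case \<open>D u \<le> 0\<close> is
  symmetric. Mixing provides such words \<open>w\<close> of two consecutive lengths; subtracting shows that \<open>\<mu>\<close> is
  within \<open>2\<epsilon>\<close> of an integer.\<close>

lemma bounded_discrepancy_imp_not_mixing:
  assumes "X \<noteq> {}"
    and disc: "\<And>w. w \<in> language X \<Longrightarrow> \<bar>real (count_list w a) - \<mu> * real (length w)\<bar> \<le> C"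
    and "0 < \<mu>" "\<mu> < 1"
  shows "\<not> topologically_mixing X"
proof
  assume mixing: "topologically_mixing X"
  define D where "D w = real (count_list w a) - \<mu> * real (length w)" for w
  have D_append: "D (v @ w) = D v + D w" for v w
    by (simp add: D_def algebra_simps)
  define \<epsilon> where "\<epsilon> = min \<mu> (1 - \<mu>) / 2"
  have "\<epsilon> > 0"
    using assms(3,4) by (simp add: \<epsilon>_def)
  define s where "s = (SUP w\<in>language X. \<bar>D w\<bar>)"
  have bdd: "bdd_above ((\<lambda>w. \<bar>D w\<bar>) ` language X)"
    using disc unfolding D_def by (rule bdd_aboveI2)
  have le_s: "\<bar>D w\<bar> \<le> s" if "w \<in> language X" for w
    unfolding s_def by (rule cSUP_upper[OF that bdd])
  obtain w0 where w0: "w0 \<in> language X"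
    using language_word_of_length[OF assms(1), of 1] by auto
  have "s - \<epsilon> < (SUP w\<in>language X. \<bar>D w\<bar>)"
    using \<open>\<epsilon> > 0\<close> by (simp add: s_def)
  then obtain u where u: "u \<in> language X" "\<bar>D u\<bar> > s - \<epsilon>"
    using less_cSUP_iff[OF _ bdd] w0 by auto
  have return: "\<bar>D (u @ w)\<bar> < \<epsilon>" if "u @ w @ u \<in> language X" "w \<noteq> []" for w
  proof -
    have "w \<in> language X"
      using that by (intro language_sublist[OF that(1)]) auto
    then have "\<bar>D w\<bar> \<le> s"
      by (rule le_s)
    moreover have "\<bar>D u + D w + D u\<bar> \<le> s"
      using le_s[OF that(1)] by (simp add: D_append add.assoc)
    ultimately show ?thesis
      using u(2) unfolding D_append by linarith
  qed
  from mixing u(1) obtain N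
    where N: "\<And>n. n \<ge> N \<Longrightarrow> \<exists>w. length w = n \<and> u @ w @ u \<in> language X"
    unfolding topologically_mixing_def by blast
  \<comment> \<open>Lengths from \<open>Suc N\<close> on: the gap words must be non-empty to belong to the language.\<close>
  obtain w where w: "length w = Suc N" "u @ w @ u \<in> language X"
    using N[of "Suc N"] by auto
  obtain w' where w': "length w' = Suc (Suc N)" "u @ w' @ u \<in> language X"
    using N[of "Suc (Suc N)"] by auto
  define k where "k = int (count_list w' a) - int (count_list w a)"
  have "D (u @ w') - D (u @ w) = real_of_int k - \<mu>"
    by (simp add: D_def k_def w(1) w'(1) algebra_simps)
  moreover have "\<bar>D (u @ w)\<bar> < \<epsilon>" "\<bar>D (u @ w')\<bar> < \<epsilon>"
    using w w' by (auto intro!: return)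
  ultimately have "\<bar>real_of_int k - \<mu>\<bar> < 2 * \<epsilon>"
    by linarith
  moreover have "2 * \<epsilon> \<le> \<mu>" "2 * \<epsilon> \<le> 1 - \<mu>"
    by (simp_all add: \<epsilon>_def)
  ultimately have "0 < real_of_int k" "real_of_int k < 1"
    by linarith+
  then show False
    by simp
qed

section \<open>Letters in legal words\<close>

lemma subst_word_Nil: "subst_word \<theta> [] = {[]}"
  by (simp add: subst_word_def)

lemma subst_word_Cons: "subst_word \<theta> (c # v) = {y @ z | y z. y \<in> \<theta> c \<and> z \<in> subst_word \<theta> v}"
proof -
  have "listset (map \<theta> (c # v)) = (\<lambda>(y, ys). y # ys) ` (\<theta> c \<times> listset (map \<theta> v))"
    by (auto simp: set_Cons_def)
  then have "subst_word \<theta> (c # v) = (\<lambda>(y, ys). y @ concat ys) ` (\<theta> c \<times> listset (map \<theta> v))"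
    unfolding subst_word_def by (simp add: image_image case_prod_unfold)
  also have "\<dots> = {y @ z | y z. y \<in> \<theta> c \<and> z \<in> subst_word \<theta> v}"
    unfolding subst_word_def by auto
  finally show ?thesis .
qed

lemma finite_subst_word:
  assumes "random_substitution \<theta>"
  shows "finite (subst_word \<theta> v)"
proof (induction v)
  case Nil
  then show ?case
    by (simp add: subst_word_Nil)
next
  case (Cons c v)
  have "finite (\<theta> c)"
    using assms by (simp add: random_substitution_def)
  with Cons show ?case
    by (simp add: subst_word_Cons finite_image_set2)
qed

lemma finite_subst_power:
  assumes "random_substitution \<theta>"
  shows "finite (subst_power \<theta> k c)"
proof (induction k)
  case 0
  then show ?case
    by (simp add: subst_power_def)
next
  case (Suc k)
  then show ?case
    by (simp add: subst_power_def subst_words_def finite_subst_word[OF assms])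
qed

lemma subst_word_append:
  "subst_word \<theta> (v @ w) = {y @ z | y z. y \<in> subst_word \<theta> v \<and> z \<in> subst_word \<theta> w}"
proof (induction v)
  case Nil
  then show ?case
    by (simp add: subst_word_Nil)
next
  case (Cons c v)
  then show ?case
    by (simp add: subst_word_Cons) (metis (no_types, opaque_lifting) append.assoc)
qed

lemma subst_word_concat:
  assumes "w \<in> subst_word \<theta> (concat ws)"
  shows "\<exists>ys. w = concat ys \<and> list_all2 (\<lambda>y v. y \<in> subst_word \<theta> v) ys ws"
  using assms
proof (induction ws arbitrary: w)
  case Nil
  then show ?case
    by (simp add: subst_word_Nil)
next
  case (Cons v ws)
  from Cons.prems obtain y z where w: "w = y @ z" "y \<in> subst_word \<theta> v"
    and z: "z \<in> subst_word \<theta> (concat ws)"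
    by (auto simp: subst_word_append)
  from Cons.IH[OF z] obtain ys where "z = concat ys" "list_all2 (\<lambda>y v. y \<in> subst_word \<theta> v) ys ws"
    by blast
  with w have "w = concat (y # ys) \<and> list_all2 (\<lambda>y v. y \<in> subst_word \<theta> v) (y # ys) (v # ws)"
    by simp
  then show ?case
    by blast
qed

lemma subst_words_power_blocks:
  assumes "w \<in> (subst_words \<theta> ^^ p) B"
  shows "\<exists>ws. w = concat ws \<and> (\<forall>y\<in>set ws. \<exists>c. y \<in> subst_power \<theta> p c)"
  using assms
proof (induction p arbitrary: w)
  case 0
  have "w = concat (map (\<lambda>c. [c]) w)"
    by (induction w) auto
  then show ?case
    by (intro exI[of _ "map (\<lambda>c. [c]) w"]) (auto simp: subst_power_def)
next
  case (Suc p)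
  from Suc.prems obtain v where v: "v \<in> (subst_words \<theta> ^^ p) B" "w \<in> subst_word \<theta> v"
    unfolding subst_words_def by auto
  from Suc.IH[OF v(1)] obtain ws where ws: "v = concat ws"
    "\<forall>y\<in>set ws. \<exists>c. y \<in> subst_power \<theta> p c"
    by blast
  obtain ys where ys: "w = concat ys" "list_all2 (\<lambda>y v. y \<in> subst_word \<theta> v) ys ws"
    using subst_word_concat v(2) ws(1) by blast
  have "\<exists>c. y \<in> subst_power \<theta> (Suc p) c" if "y \<in> set ys" for y
  proof -
    from ys(2) that obtain v' where v': "v' \<in> set ws" "y \<in> subst_word \<theta> v'"
      by (metis in_set_conv_nth list_all2_conv_all_nth)
    with ws(2) obtain c where "v' \<in> subst_power \<theta> p c"
      by blast
    with v'(2) have "y \<in> subst_power \<theta> (Suc p) c"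
      unfolding subst_power_def subst_words_def by auto
    then show ?thesis ..
  qed
  with ys(1) show ?case
    by blast
qed

lemma subst_matrix_entry:
  assumes "compatible \<theta>" "y \<in> \<theta> j"
  shows "subst_matrix \<theta> $ i $ j = real (count_list y i)"
proof -
  have "(THE c. \<forall>w\<in>\<theta> j. count_list w i = c) = count_list y i"
    using assms unfolding compatible_def by (intro the_equality) metis+
  then show ?thesis
    by (simp add: subst_matrix_def)
qed

lemma count_list_subst_word:
  assumes "compatible \<theta>" "w \<in> subst_word \<theta> v"
  shows "real (count_list w i) =
    (\<Sum>j\<in>UNIV. subst_matrix \<theta> $ i $ j * real (count_list v j))"
  using assms(2)
proof (induction v arbitrary: w)
  case Nil
  then show ?case
    by (simp add: subst_word_Nil)
next
  case (Cons c v)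
  then obtain y z where "w = y @ z" "y \<in> \<theta> c" "z \<in> subst_word \<theta> v"
    by (auto simp: subst_word_Cons)
  moreover have "(\<Sum>j\<in>UNIV. subst_matrix \<theta> $ i $ j * real (count_list (c # v) j)) =
      (\<Sum>j\<in>UNIV. subst_matrix \<theta> $ i $ j * real (count_list v j) +
        (if j = c then subst_matrix \<theta> $ i $ j else 0))"
    by (rule sum.cong) (auto simp: algebra_simps)
  ultimately show ?case
    using Cons.IH[of z] subst_matrix_entry[OF assms(1), of y c i] by (simp add: sum.distrib)
qed

text \<open>Compatibility makes abelianisation commute with \<open>\<theta>\<close>, so the substitution matrix of \<open>\<theta>\<^sup>p\<close> is the
  \<open>p\<close>-th power of that of \<open>\<theta>\<close>; this is how primitivity becomes a statement about words.\<close>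

lemma count_list_subst_power:
  assumes "compatible \<theta>" "w \<in> subst_power \<theta> p c"
  shows "real (count_list w i) = (((**) (subst_matrix \<theta>) ^^ p) (mat 1)) $ i $ c"
  using assms(2)
proof (induction p arbitrary: w i)
  case 0
  then show ?case
    by (auto simp: subst_power_def mat_def)
next
  case (Suc p)
  then obtain v where "v \<in> subst_power \<theta> p c" "w \<in> subst_word \<theta> v"
    by (auto simp: subst_power_def subst_words_def)
  then show ?case
    using Suc.IH count_list_subst_word[OF assms(1)] by (simp add: matrix_matrix_mult_def)
qed

lemma primitive_power_contains_letters:
  assumes "compatible \<theta>" "primitive \<theta>"
  obtains p where "\<And>w c a. w \<in> subst_power \<theta> p c \<Longrightarrow> a \<in> set w"
proof -
  from assms(2) obtain p where p: "\<forall>i j. (((**) (subst_matrix \<theta>) ^^ p) (mat 1)) $ i $ j > 0"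
    by (auto simp: primitive_def)
  show ?thesis
  proof (rule that[of p])
    fix w c a
    assume "w \<in> subst_power \<theta> p c"
    then have "real (count_list w a) > 0"
      using p by (simp add: count_list_subst_power[OF assms(1)])
    then show "a \<in> set w"
      using count_notin by fastforce
  qed
qed

text \<open>A factor that misses \<open>a\<close> contains no complete block, so it consists of a suffix of one block and a
  prefix of the next, or lies inside one block.\<close>

lemma length_sublist_concat_avoiding:
  assumes blocks: "\<And>y. y \<in> set ws \<Longrightarrow> a \<in> set y \<and> length y \<le> B"
    and "sublist u (concat ws)" "a \<notin> set u"
  shows "length u \<le> 2 * B"
proof -
  have pre: "length v \<le> B"
    if "\<forall>y\<in>set vs. a \<in> set y \<and> length y \<le> B" "prefix v (concat vs)" "a \<notin> set v" for v vs
  proof (cases vs)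
    case Nil
    with that show ?thesis
      by simp
  next
    case (Cons y ys)
    have "\<not> prefix y v"
      using that(1,3) Cons set_mono_prefix by fastforce
    then have "prefix v y"
      using that(2) Cons by (metis concat.simps(2) prefix_append prefixI prefix_same_cases)
    then show ?thesis
      using that(1) Cons prefix_length_le by fastforce
  qed
  show ?thesis
    using assms
  proof (induction ws arbitrary: u)
    case Nil
    then show ?case
      by simp
  next
    case (Cons y ws)
    from Cons.prems(2) consider "sublist u y" | "sublist u (concat ws)" |
      u1 u2 where "u = u1 @ u2" "suffix u1 y" "prefix u2 (concat ws)"
      by (auto simp: sublist_append)
    then show ?case
    proof cases
      case 1
      then show ?thesis
        using Cons.prems(1)[of y] sublist_length_le by fastforce
    next
      case 2
      then show ?thesis
        using Cons by auto
    next
      case 3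
      have "length u1 \<le> B"
        using Cons.prems(1)[of y] suffix_length_le[OF 3(2)] by simp
      moreover have "length u2 \<le> B"
        using Cons.prems 3 by (intro pre[of ws]) auto
      ultimately show ?thesis
        using 3(1) by simp
    qed
  qed
qed

text \<open>Let every word in \<open>\<theta>\<^sup>p(c)\<close>, for every letter \<open>c\<close>, contain all letters. A legal word comes from some
  \<open>\<theta>\<^sup>k(c)\<close>. If \<open>k > p\<close>, it is a factor of a concatenation of words of that kind, so if it misses a letter
  it meets at most two of them; if \<open>k \<le> p\<close>, it is a factor of one of
  finitely many words.\<close>

lemma legal_words_avoiding_letter_bounded:
  fixes \<theta> :: "'a::finite \<Rightarrow> 'a list set"
  assumes "random_substitution \<theta>" "compatible \<theta>" "primitive \<theta>"
  obtains G where "\<And>u a. legal \<theta> u \<Longrightarrow> a \<notin> set u \<Longrightarrow> length u \<le> G"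
proof -
  obtain p where p: "\<And>w c a. w \<in> subst_power \<theta> p c \<Longrightarrow> a \<in> set w"
    using primitive_power_contains_letters[OF assms(2,3)] by blast
  have "finite (\<Union>k\<in>{..p}. \<Union>c. subst_power \<theta> k c)"
    using finite_subst_power[OF assms(1)] by auto
  then have "finite (length ` (\<Union>k\<in>{..p}. \<Union>c. subst_power \<theta> k c))"
    by blast
  then obtain B where "\<forall>n\<in>length ` (\<Union>k\<in>{..p}. \<Union>c. subst_power \<theta> k c). n \<le> B"
    unfolding finite_nat_set_iff_bounded_le by blast
  then have B: "\<And>k c w. k \<le> p \<Longrightarrow> w \<in> subst_power \<theta> k c \<Longrightarrow> length w \<le> B"
    by blast
  show ?thesis
  proof (rule that[of "2 * B"])
    fix u a
    assume "legal \<theta> u" and a: "a \<notin> set u"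
    then obtain k c w where w: "w \<in> subst_power \<theta> k c" "sublist u w"
      by (auto simp: legal_def)
    show "length u \<le> 2 * B"
    proof (cases "k \<le> p")
      case True
      then show ?thesis
        using B[OF True w(1)] sublist_length_le[OF w(2)] by simp
    next
      case False
      then have "w \<in> (subst_words \<theta> ^^ (p + (k - p))) {[c]}"
        using w(1) by (simp add: subst_power_def)
      then have "w \<in> (subst_words \<theta> ^^ p) ((subst_words \<theta> ^^ (k - p)) {[c]})"
        by (simp add: funpow_add)
      then obtain ws where ws: "w = concat ws" "\<forall>y\<in>set ws. \<exists>c. y \<in> subst_power \<theta> p c"
        using subst_words_power_blocks by blast
      show ?thesis
      proof (rule length_sublist_concat_avoiding[OF _ _ a])
        show "sublist u (concat ws)"
          using w(2) ws(1) by simp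
        show "a \<in> set y \<and> length y \<le> B" if "y \<in> set ws" for y
          using ws(2) that p B[of p] by blast
      qed
    qed
  qed
qed

section \<open>Balanced random substitutions\<close>

theorem theorem16:
  fixes \<theta> :: "'a::finite \<Rightarrow> 'a list set" and C :: real
  assumes "CARD('a) \<ge> 2"
    and "random_substitution \<theta>"
    and "compatible \<theta>"
    and "primitive \<theta>"
    and "rs_subshift \<theta> \<noteq> {}"
    and "balanced C (rs_subshift \<theta>)"
  shows "\<exists>N\<ge>1. \<forall>n\<ge>N. (\<exists>u. recognisable \<theta> n u) \<longrightarrow> \<not> topologically_mixing (rs_subshift \<theta>)"
proof -
  let ?X = "rs_subshift \<theta>"
  obtain G where G: "\<And>u a. legal \<theta> u \<Longrightarrow> a \<notin> set u \<Longrightarrow> length u \<le> G"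
    using legal_words_avoiding_letter_bounded[OF assms(2-4)] by blast
  have gap: "length w \<le> G" if "w \<in> language ?X" "a \<notin> set w" for w a
    using that by (auto simp: language_def rs_subshift_def intro!: G)
  obtain a b :: 'a where "a \<noteq> b"
    using assms(1) by (metis card_2_iff' ex_card)
  obtain \<mu> where \<mu>: "\<And>w. w \<in> language ?X \<Longrightarrow>
      \<bar>real (count_list w a) - \<mu> * real (length w)\<bar> \<le> C"
    using balanced_frequency[OF assms(5,6)] by blast
  obtain \<nu> where \<nu>: "\<And>w. w \<in> language ?X \<Longrightarrow>
      \<bar>real (count_list w b) - \<nu> * real (length w)\<bar> \<le> C"
    using balanced_frequency[OF assms(5,6)] by blast
  have "\<mu> > 0"
    by (rule frequency_pos[OF assms(5) \<mu> gap[of _ a]])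
  moreover have "\<nu> > 0"
    by (rule frequency_pos[OF assms(5) \<nu> gap[of _ b]])
  moreover have "\<mu> + \<nu> \<le> 1"
    using frequency_add_le_1[OF assms(5) \<open>a \<noteq> b\<close> \<mu> \<nu>] .
  ultimately have "\<not> topologically_mixing ?X"
    using bounded_discrepancy_imp_not_mixing[OF assms(5) \<mu>] by simp
  then show ?thesis
    by auto
qed

end
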